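(* Let $0<s<1$ and $0<q<1$, and put $$u(q,s)=\frac{\ln\dfrac{q^s-q}{(1-s)(1-q)}}{\ln q}.$$ Then the function $$x\mapsto g_q(x;s,1,u(q,s))=\Big(\frac{1-q^{x+u(q,s)}}{1-q}\Big)^{s-1}\frac{\Gamma_q(x+1)}{\Gamma_q(x+s)}$$ is logarithmically completely monotonic on $(0,+\infty)$.
   Context: For $0<q<1$ and $x>0$ the $q$-gamma function is $\Gamma_q(x)=(1-q)^{1-x}\prod_{n=0}^{\infty}\frac{1-q^{n+1}}{1-q^{n+x}}$. A function $f$ is completely monotonic on an interval $(a,b)$ if it has derivatives of all orders there and $(-1)^kf^{(k)}(x)\ge 0$ for all $x\in(a,b)$ and all integers $k\ge 0$. A positive function $f$ is logarithmically completely monotonic on an interval if $f=e^{-h}$ with $h'$ completely monotonic on that interval. In general, $g_q(x;a,b,c)=\big(\frac{1-q^{x+c}}{1-q}\big)^{a-b}\frac{\Gamma_q(x+b)}{\Gamma_q(x+a)}$. *)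

theory Defs
  imports "HOL-Analysis.Analysis"
begin

definition q_gamma :: "real \<Rightarrow> real \<Rightarrow> real" where
  "q_gamma q x =
     (1 - q) powr (1 - x) * (\<Prod>n. (1 - q ^ (n + 1)) / (1 - q powr (real n + x)))"

(* I stands for an open, possibly unbounded, interval; on open sets the two-sided
   derivatives used below depend only on the values of f on I. *)
definition completely_monotonic_on :: "(real \<Rightarrow> real) \<Rightarrow> real set \<Rightarrow> bool" where
  "completely_monotonic_on f I \<longleftrightarrow>
     (\<forall>k. \<forall>x\<in>I. ((deriv ^^ k) f) differentiable (at x)) \<and>
     (\<forall>k. \<forall>x\<in>I. (-1) ^ k * (deriv ^^ k) f x \<ge> 0)"

definition log_completely_monotonic_on :: "(real \<Rightarrow> real) \<Rightarrow> real set \<Rightarrow> bool" where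
  "log_completely_monotonic_on f I \<longleftrightarrow>
     (\<forall>x\<in>I. f x > 0) \<and>
     (\<exists>h. (\<forall>x\<in>I. f x = exp (- h x)) \<and>
          (\<forall>x\<in>I. h differentiable (at x)) \<and>
          completely_monotonic_on (deriv h) I)"

definition g_q :: "real \<Rightarrow> real \<Rightarrow> real \<Rightarrow> real \<Rightarrow> real \<Rightarrow> real" where
  "g_q q x a b c =
     ((1 - q powr (x + c)) / (1 - q)) powr (a - b) * (q_gamma q (x + b) / q_gamma q (x + a))"

definition u_qs :: "real \<Rightarrow> real \<Rightarrow> real" where
  "u_qs q s = ln ((q powr s - q) / ((1 - s) * (1 - q))) / ln q"

end

theory Submission
  imports Defs
begin

text \<open>
  Put \<open>A = q powr u\<close>. Expanding the logarithms of \<open>g\<close> in powers of \<open>y = q powr x\<close> gives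
  \<open>- ln g = \<Sum>k\<ge>1. (y ^ k / k) * (((q powr s) ^ k - q ^ k) / (1 - q ^ k) - (1 - s) * A ^ k)\<close>.
  Termwise differentiation in \<open>x\<close> multiplies the \<open>k\<close>-th coefficient by \<open>k * ln q < 0\<close>, so it suffices
  that no coefficient is positive. Writing \<open>r = 1 - s\<close> and
  \<open>F k = (1 - q powr (r * k)) / (r * (1 - q ^ k))\<close>, this says \<open>F k \<le> F 1 ^ k\<close>, and it follows
  from \<open>F (k + 1) \<le> F k * F 1\<close>, which is a consequence of the monotonicity of \<open>t * coth (t / 2)\<close>.
\<close>

section \<open>The inequality for the coefficients\<close>

lemma sinh_ge_self:
  fixes t :: real
  assumes "0 \<le> t"
  shows "t \<le> sinh t"
proof -
  have "sinh 0 - 0 \<le> sinh t - t"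
  proof (rule DERIV_nonneg_imp_nondecreasing[OF assms])
    fix x :: real
    have "((\<lambda>x. sinh x - x) has_real_derivative (cosh x - 1)) (at x)"
      by (auto intro!: derivative_eq_intros)
    then show "\<exists>y. ((\<lambda>x. sinh x - x) has_real_derivative y) (at x) \<and> 0 \<le> y"
      using cosh_real_ge_1[of x] by auto
  qed
  then show ?thesis by simp
qed

text \<open>The function is \<open>t * coth (t / 2)\<close> written in \<open>exp (- t)\<close>.
  After simplification the numerator of its derivative is
  \<open>2 * exp (- t) * (sinh t - t)\<close>, which is nonnegative by
  \<open>sinh_ge_self\<close>.\<close>

lemma mult_coth_half_mono:
  fixes a b :: real
  assumes "0 < a" "a \<le> b"
  shows "a * ((1 + exp (- a)) / (1 - exp (- a))) \<le> b * ((1 + exp (- b)) / (1 - exp (- b)))"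
proof (rule DERIV_nonneg_imp_nondecreasing[OF assms(2)])
  fix t :: real
  assume "a \<le> t"
  with assms have t: "0 < t" by simp
  let ?E = "exp (- t)"
  let ?D = "((1 + ?E - ?E * t) * (1 - ?E) - t * (1 + ?E) * ?E) / ((1 - ?E) * (1 - ?E))"
  have E: "?E < 1" "0 < ?E" using t by auto
  have "((\<lambda>t. t * ((1 + exp (- t)) / (1 - exp (- t)))) has_real_derivative ?D) (at t)"
    using E by (auto intro!: derivative_eq_intros)
  moreover have "?D = (1 - ?E * ?E - 2 * t * ?E) / ((1 - ?E) * (1 - ?E))"
    by (rule arg_cong2[where f = "(/)"]) (simp_all add: algebra_simps)
  moreover have "0 \<le> \<dots>"
  proof (rule divide_nonneg_nonneg)
    have "?E * (2 * sinh t - 2 * t) = 1 - ?E * ?E - 2 * t * ?E"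
      by (simp add: sinh_def algebra_simps flip: exp_add)
    moreover have "0 \<le> ?E * (2 * sinh t - 2 * t)"
      using sinh_ge_self[of t] t by simp
    ultimately show "0 \<le> 1 - ?E * ?E - 2 * t * ?E" by simp
  qed simp
  ultimately show "\<exists>y. ((\<lambda>t. t * ((1 + exp (- t)) / (1 - exp (- t)))) has_real_derivative y) (at t) \<and> 0 \<le> y"
    by auto
qed

text \<open>With \<open>x = exp (- t)\<close> this compares the values of
  \<open>t * coth (t / 2)\<close> at \<open>r * t\<close> and at \<open>t\<close>, and then cancels
  the positive factor \<open>t\<close>.\<close>

lemma coth_ratio_powr:
  fixes x r :: real
  assumes "0 < x" "x < 1" "0 < r" "r < 1"
  shows "r * ((1 + x powr r) / (1 - x powr r)) \<le> (1 + x) / (1 - x)"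
proof -
  define t where "t = - ln x"
  have t: "0 < t" "x = exp (- t)" "x powr r = exp (- (r * t))"
    using assms by (auto simp: t_def powr_def)
  have "(r * t) * ((1 + exp (- (r * t))) / (1 - exp (- (r * t))))
      \<le> t * ((1 + exp (- t)) / (1 - exp (- t)))"
    using assms t by (intro mult_coth_half_mono) auto
  then have "t * (r * ((1 + exp (- (r * t))) / (1 - exp (- (r * t)))))
      \<le> t * ((1 + exp (- t)) / (1 - exp (- t)))"
    by (simp add: mult_ac)
  then show ?thesis using t by (simp only: mult_le_cancel_left_pos)
qed

text \<open>The addition formula \<open>coth a + coth b = sinh (a + b) / (sinh a * sinh b)\<close>
  in exponential variables. It turns a sum of two coth bounds into an inequality between
  products.\<close>

lemma coth_addition:
  fixes x y :: real
  assumes "x < 1" "y < 1"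
  shows "(1 + x) / (1 - x) + (1 + y) / (1 - y) = 2 * ((1 - x * y) / ((1 - x) * (1 - y)))"
  using assms by (simp add: divide_simps) (simp add: algebra_simps)

text \<open>The bound \<open>F k \<le> F 1 ^ k\<close> by induction. It is stated for
  \<open>Suc k\<close> because the denominator of \<open>F\<close> vanishes at exponent 0.\<close>

lemma one_minus_power_ratio_le:
  fixes q r :: real and k :: nat
  assumes q: "0 < q" "q < 1" and r: "0 < r" "r < 1"
  shows "(1 - (q powr r) ^ Suc k) / (r * (1 - q ^ Suc k)) \<le> ((1 - q powr r) / (r * (1 - q))) ^ Suc k"
proof (induction k)
  case 0
  then show ?case by simp
next
  case (Suc k)
  define p where "p = q powr r"
  define x where "x = q ^ Suc k"
  have p: "0 < p" "p < 1" using q r by (auto simp: p_def powr_def mult_neg_neg mult_pos_neg)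
  have x: "0 < x" "x < 1" using q power_Suc_less_one[of q k] by (auto simp: x_def)
  have px: "x powr r = p ^ Suc k"
    using q by (simp add: p_def x_def powr_mult powr_powr mult.commute flip: powr_realpow)
  define y where "y = p ^ Suc k"
  have y: "0 < y" "y < 1" using p power_Suc_less_one[of p k] by (auto simp: y_def)
  \<comment> \<open>The coth bound is applied at \<open>q\<close> and at
    \<open>x = q ^ Suc k\<close>, whose \<open>r\<close>-th powers are \<open>p\<close> and
    \<open>y\<close>.\<close>
  have "r * ((1 + p) / (1 - p)) + r * ((1 + y) / (1 - y)) \<le> (1 + q) / (1 - q) + (1 + x) / (1 - x)"
    using coth_ratio_powr[OF q r] coth_ratio_powr[OF x r] by (simp add: px y_def p_def)
  then have "r * (2 * ((1 - p * y) / ((1 - p) * (1 - y)))) \<le> 2 * ((1 - q * x) / ((1 - q) * (1 - x)))"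
    using coth_addition[of p y] coth_addition[of q x] p y q x
    by (simp only: distrib_left[symmetric])
  then have main: "r * ((1 - p * y) / ((1 - p) * (1 - y))) \<le> (1 - q * x) / ((1 - q) * (1 - x))"
    by (simp only: mult.left_commute[of r 2] mult_le_cancel_left_pos zero_less_numeral)
  have qx: "q * x < 1" using mult_strict_mono[of q 1 x 1] q x by simp
  \<comment> \<open>The second factor is chosen so that bounding the first one by
    \<open>main\<close> leaves exactly the product of \<open>F 1\<close> and
    \<open>F (k + 1)\<close>.\<close>
  have "(1 - p * y) / (r * (1 - q * x))
      = r * ((1 - p * y) / ((1 - p) * (1 - y))) * ((1 - p) * (1 - y) / (r * r * (1 - q * x)))"
    using p y r by (simp add: divide_simps)
  also have "\<dots> \<le> (1 - q * x) / ((1 - q) * (1 - x)) * ((1 - p) * (1 - y) / (r * r * (1 - q * x)))"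
    using p y qx r by (intro mult_right_mono main) auto
  also have "\<dots> = ((1 - p) / (r * (1 - q))) * ((1 - y) / (r * (1 - x)))"
    using qx by (simp add: divide_simps)
  also have "\<dots> \<le> ((1 - p) / (r * (1 - q))) * ((1 - p) / (r * (1 - q))) ^ Suc k"
    using Suc.IH p q r by (intro mult_left_mono) (auto simp: p_def x_def y_def)
  finally show ?case by (simp add: p_def x_def y_def)
qed

section \<open>Power series in \<open>q powr x\<close>\<close>

text \<open>Radius of convergence at least 1: this covers all values of \<open>q powr x\<close> with
  \<open>x > 0\<close>.\<close>

definition summable_on_unit :: "(nat \<Rightarrow> real) \<Rightarrow> bool" where
  "summable_on_unit c \<longleftrightarrow> (\<forall>y. \<bar>y\<bar> < 1 \<longrightarrow> summable (\<lambda>k. c k * y ^ k))"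

lemma summable_on_unitD: "summable_on_unit c \<Longrightarrow> \<bar>y\<bar> < 1 \<Longrightarrow> summable (\<lambda>k. c k * y ^ k)"
  by (simp add: summable_on_unit_def)

lemma summable_on_unit_bounded:
  assumes "\<And>k. \<bar>c k\<bar> \<le> B"
  shows "summable_on_unit c"
  unfolding summable_on_unit_def
proof (intro allI impI)
  fix y :: real
  assume "\<bar>y\<bar> < 1"
  then have "summable (\<lambda>k. B * \<bar>y\<bar> ^ k)" by (intro summable_mult summable_geometric) simp
  then show "summable (\<lambda>k. c k * y ^ k)"
    by (rule summable_comparison_test'[where N = 0])
      (use assms in \<open>auto simp: abs_mult power_abs intro!: mult_right_mono\<close>)
qed

lemma summable_on_unit_cmult: "summable_on_unit c \<Longrightarrow> summable_on_unit (\<lambda>k. c k * b)"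
  unfolding summable_on_unit_def using summable_mult2[where c = b] by (force simp: mult_ac)

text \<open>The second claim is the operator y d/dy, which keeps each exponent in place, unlike
  \<open>diffs\<close>. It is the form that d/dx takes on series in \<open>q powr x\<close>, up to
  the factor \<open>ln q\<close>.\<close>

lemma powser_termdiff:
  assumes c: "summable_on_unit c" and y: "\<bar>y\<bar> < 1"
  shows "summable (\<lambda>k. diffs c k * y ^ k)"
    and "(\<lambda>k. (c k * real k) * y ^ k) sums (y * (\<Sum>k. diffs c k * y ^ k))"
proof -
  show *: "summable (\<lambda>k. diffs c k * y ^ k)"
    by (rule termdiff_converges[where K = 1]) (use c y in \<open>auto dest: summable_on_unitD\<close>)
  have "(\<lambda>k. y * (diffs c k * y ^ k)) sums (y * (\<Sum>k. diffs c k * y ^ k))"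
    by (intro sums_mult summable_sums *)
  then have "(\<lambda>k. (c (Suc k) * real (Suc k)) * y ^ Suc k) sums (y * (\<Sum>k. diffs c k * y ^ k))"
    by (simp add: diffs_def mult_ac)
  \<comment> \<open>The term at index 0 carries the factor \<open>real 0\<close>, so the index shift
    leaves the sum unchanged.\<close>
  then show "(\<lambda>k. (c k * real k) * y ^ k) sums (y * (\<Sum>k. diffs c k * y ^ k))"
    by (subst (asm) sums_Suc_iff) simp
qed

lemma summable_on_unit_mult_nat: "summable_on_unit c \<Longrightarrow> summable_on_unit (\<lambda>k. c k * real k)"
  using powser_termdiff(2) sums_summable unfolding summable_on_unit_def[of "\<lambda>k. c k * real k"] by blast

definition qseries :: "real \<Rightarrow> (nat \<Rightarrow> real) \<Rightarrow> real \<Rightarrow> real" where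
  "qseries q c x = (\<Sum>k. c k * (q powr x) ^ k)"

lemma powr_less_one_pos:
  fixes q x :: real
  assumes "0 < q" "q < 1" "0 < x"
  shows "0 < q powr x" "q powr x < 1" "\<bar>q powr x\<bar> < 1"
  using assms by (auto simp: powr_def mult_pos_neg)

lemma qseries_has_derivative:
  assumes q: "0 < q" "q < 1" and c: "summable_on_unit c" and x: "0 < x"
  shows "(qseries q c has_real_derivative qseries q (\<lambda>k. c k * (real k * ln q)) x) (at x)"
proof -
  let ?y = "q powr x"
  have y: "\<bar>?y\<bar> < 1" using powr_less_one_pos[OF q x] by simp
  \<comment> \<open>A point of convergence strictly beyond \<open>?y\<close> justifies
    differentiating termwise at \<open>?y\<close>.\<close>
  then obtain K where "\<bar>?y\<bar> < K" "K < 1" using dense by blast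
  then have K: "\<bar>?y\<bar> < \<bar>K\<bar>" "\<bar>K\<bar> < 1" by linarith+
  have "((\<lambda>y. \<Sum>k. c k * y ^ k) has_real_derivative (\<Sum>k. diffs c k * ?y ^ k)) (at ?y)"
    by (rule termdiffs_strong[where K = K])
      (use K c in \<open>simp_all add: summable_on_unitD\<close>)
  moreover have "((\<lambda>x. q powr x) has_real_derivative (?y * ln q)) (at x)"
    using q by (auto intro!: derivative_eq_intros)
  ultimately have "((\<lambda>x. \<Sum>k. c k * (q powr x) ^ k) has_real_derivative
      (\<Sum>k. diffs c k * ?y ^ k) * (?y * ln q)) (at x)"
    by (rule DERIV_chain2)
  moreover have "(\<lambda>k. (c k * real k) * ?y ^ k * ln q) sums (?y * (\<Sum>k. diffs c k * ?y ^ k) * ln q)"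
    by (intro sums_mult2 powser_termdiff(2)[OF c y])
  then have "qseries q (\<lambda>k. c k * (real k * ln q)) x = (\<Sum>k. diffs c k * ?y ^ k) * (?y * ln q)"
    by (simp add: qseries_def sums_iff mult_ac)
  ultimately show ?thesis by (simp add: qseries_def[abs_def])
qed

lemma summable_on_unit_deriv:
  "summable_on_unit c \<Longrightarrow> summable_on_unit (\<lambda>k. c k * (real k * ln q) ^ m)"
proof (induction m)
  case (Suc m)
  have "summable_on_unit (\<lambda>k. c k * (real k * ln q) ^ m * real k * ln q)"
    by (intro summable_on_unit_cmult summable_on_unit_mult_nat Suc)
  then show ?case by (simp add: mult_ac)
qed simp

lemma deriv_eq_on_halfline:
  fixes f g :: "real \<Rightarrow> real"
  assumes "\<And>x. 0 < x \<Longrightarrow> f x = g x" and "0 < x" and "(g has_real_derivative D) (at x)"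
  shows "(f has_real_derivative D) (at x)"
  by (rule has_field_derivative_transform_within_open[OF assms(3), of "{0<..}"])
    (use assms in auto)

lemma qseries_iterated_deriv:
  assumes q: "0 < q" "q < 1" and c: "summable_on_unit c"
    and f: "\<And>x. 0 < x \<Longrightarrow> f x = qseries q c x"
  shows "0 < x \<Longrightarrow> (deriv ^^ m) f x = qseries q (\<lambda>k. c k * (real k * ln q) ^ m) x"
proof (induction m arbitrary: x)
  case 0
  then show ?case by (simp add: f)
next
  case (Suc m)
  have "((deriv ^^ m) f has_real_derivative
      qseries q (\<lambda>k. c k * (real k * ln q) ^ m * (real k * ln q)) x) (at x)"
    by (rule deriv_eq_on_halfline[OF Suc.IH Suc.prems
          qseries_has_derivative[OF q summable_on_unit_deriv[OF c] Suc.prems]])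
  then show ?case by (simp add: DERIV_imp_deriv mult_ac)
qed

text \<open>Since \<open>ln q < 0\<close>, the sign \<open>(-1) ^ m\<close> turns
  \<open>(real k * ln q) ^ m\<close> into a nonnegative power, so every term is nonnegative.
  Agreement of \<open>f\<close> with the series on the half-line suffices because that set is
  open.\<close>

lemma qseries_completely_monotonic:
  assumes q: "0 < q" "q < 1" and c: "summable_on_unit c" "\<And>k. 0 \<le> c k"
    and f: "\<And>x. 0 < x \<Longrightarrow> f x = qseries q c x"
  shows "completely_monotonic_on f {0<..}"
  unfolding completely_monotonic_on_def
proof (intro conjI allI ballI)
  fix m x
  assume "x \<in> {0::real<..}"
  then have x: "0 < x" by simp
  let ?d = "\<lambda>k. c k * (real k * ln q) ^ m"
  have d: "summable_on_unit ?d" using c by (intro summable_on_unit_deriv)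
  have eq: "(deriv ^^ m) f z = qseries q ?d z" if "0 < z" for z
    using qseries_iterated_deriv[OF q c(1) f that] .
  show "((deriv ^^ m) f) differentiable (at x)"
    using deriv_eq_on_halfline[OF eq x qseries_has_derivative[OF q d x]]
    by (auto simp: real_differentiable_def)
  have "0 \<le> (\<Sum>k. (-1) ^ m * (?d k * (q powr x) ^ k))"
  proof (rule suminf_nonneg)
    show "summable (\<lambda>k. (-1) ^ m * (?d k * (q powr x) ^ k))"
      using summable_on_unitD[OF d powr_less_one_pos(3)[OF q x]] by (rule summable_mult)
    fix k
    have "(-1) ^ m * (?d k * (q powr x) ^ k) = c k * (real k * - ln q) ^ m * (q powr x) ^ k"
      unfolding mult_minus_right by (subst power_minus) simp
    also have "0 \<le> \<dots>" using c(2) q by (intro mult_nonneg_nonneg zero_le_power) auto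
    finally show "0 \<le> (-1) ^ m * (?d k * (q powr x) ^ k)" .
  qed
  also have "\<dots> = (-1) ^ m * (deriv ^^ m) f x"
    using summable_on_unitD[OF d powr_less_one_pos(3)[OF q x]]
    by (simp only: eq[OF x] qseries_def suminf_mult)
  finally show "0 \<le> (-1) ^ m * (deriv ^^ m) f x" .
qed

section \<open>The q-gamma function\<close>

text \<open>Expanding each \<open>1 / (1 - q ^ k)\<close> geometrically shows that these are the
  coefficients of -ln of the infinite product of the factors \<open>1 - y * q ^ n\<close>. At
  \<open>k = 0\<close> division by zero gives the value 0, the right constant term.\<close>

definition lq_coeff :: "real \<Rightarrow> nat \<Rightarrow> real" where
  "lq_coeff q k = 1 / (real k * (1 - q ^ k))"

lemma summable_on_unit_lq_coeff:
  assumes q: "0 < q" "q < 1"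
  shows "summable_on_unit (lq_coeff q)"
proof (rule summable_on_unit_bounded)
  fix k
  show "\<bar>lq_coeff q k\<bar> \<le> 1 / (1 - q)"
  proof (cases k)
    case (Suc n)
    have "q ^ k \<le> q" using q Suc by (simp add: mult_left_le power_le_one)
    then have "1 * (1 - q) \<le> real k * (1 - q ^ k)"
      using q Suc by (intro mult_mono) auto
    then show ?thesis using q by (auto simp: lq_coeff_def frac_le abs_if)
  qed (use q in \<open>simp add: lq_coeff_def\<close>)
qed

lemma neg_ln_one_minus_sums:
  fixes y :: real
  assumes "\<bar>y\<bar> < 1"
  shows "(\<lambda>k. y ^ k / real k) sums (- ln (1 - y))"
  using sums_minus[OF ln_series'[of "- y"]] assms by simp

text \<open>Shifting \<open>x\<close> by 1 multiplies the \<open>k\<close>-th term by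
  \<open>q ^ k\<close>; the difference cancels \<open>1 - q ^ k\<close> and leaves the logarithm
  series.\<close>

lemma qseries_lq_diff:
  assumes q: "0 < q" "q < 1" and x: "0 < x"
  shows "qseries q (lq_coeff q) x - qseries q (lq_coeff q) (x + 1) = - ln (1 - q powr x)"
proof -
  let ?y = "q powr x"
  have *: "(\<lambda>k. lq_coeff q k * (q powr z) ^ k) sums qseries q (lq_coeff q) z" if "0 < z" for z
    unfolding qseries_def using q that
    by (intro summable_sums summable_on_unitD[OF summable_on_unit_lq_coeff] powr_less_one_pos) auto
  have "(\<lambda>k. lq_coeff q k * ?y ^ k - lq_coeff q k * (q powr (x + 1)) ^ k) sums
      (qseries q (lq_coeff q) x - qseries q (lq_coeff q) (x + 1))"
    using x by (intro sums_diff *) auto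
  also have "(\<lambda>k. lq_coeff q k * ?y ^ k - lq_coeff q k * (q powr (x + 1)) ^ k) = (\<lambda>k. ?y ^ k / real k)"
  proof
    fix k
    show "lq_coeff q k * ?y ^ k - lq_coeff q k * (q powr (x + 1)) ^ k = ?y ^ k / real k"
    proof (cases k)
      case (Suc n)
      then have "q ^ k < 1" using q power_Suc_less_one by blast
      moreover have "lq_coeff q k * ?y ^ k - lq_coeff q k * (q powr (x + 1)) ^ k
          = ?y ^ k * (1 - q ^ k) * lq_coeff q k"
        using q by (simp add: powr_add power_mult_distrib algebra_simps)
      ultimately show ?thesis by (simp add: lq_coeff_def)
    qed (simp add: lq_coeff_def)
  qed
  finally show ?thesis
    using neg_ln_one_minus_sums[OF powr_less_one_pos(3)[OF q x]] by (rule sums_unique2)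
qed

text \<open>The argument \<open>q powr (real n + x)\<close> tends to 0, and continuity of the power
  series there leaves its constant term.\<close>

lemma qseries_tendsto_at_top:
  assumes q: "0 < q" "q < 1" and c: "summable_on_unit c"
  shows "(\<lambda>n. qseries q c (real n + x)) \<longlonglongrightarrow> c 0"
proof -
  have "isCont (\<lambda>y. \<Sum>k. c k * y ^ k) 0"
    by (rule isCont_powser[where K = "1/2"]) (use c in \<open>auto intro!: summable_on_unitD\<close>)
  moreover have "(\<lambda>n. q ^ n * q powr x) \<longlonglongrightarrow> 0 * q powr x"
    using q by (intro tendsto_intros LIMSEQ_power_zero) auto
  ultimately have "(\<lambda>n. \<Sum>k. c k * (q ^ n * q powr x) ^ k) \<longlonglongrightarrow> (\<Sum>k. c k * 0 ^ k)"
    by (intro isCont_tendsto_compose[of 0 "\<lambda>y. \<Sum>k. c k * y ^ k"]) auto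
  then show ?thesis using q by (simp add: qseries_def powr_add powr_realpow)
qed

text \<open>Telescoping the difference equation replaces an interchange of two infinite sums; the
  limit term is \<open>lq_coeff q 0 = 0\<close>.\<close>

lemma ln_one_minus_sums_qseries:
  assumes q: "0 < q" "q < 1" and x: "0 < x"
  shows "(\<lambda>n. - ln (1 - q powr (real n + x))) sums qseries q (lq_coeff q) x"
proof -
  let ?D = "qseries q (lq_coeff q)"
  have "(\<lambda>n. ?D (real n + x) - ?D (real (Suc n) + x)) sums (?D (real 0 + x) - lq_coeff q 0)"
    by (rule telescope_sums'[OF qseries_tendsto_at_top[OF q summable_on_unit_lq_coeff[OF q]]])
  moreover have "?D (real n + x) - ?D (real (Suc n) + x) = - ln (1 - q powr (real n + x))" for n
    using qseries_lq_diff[OF q, of "real n + x"] x by (simp add: add_ac)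
  ultimately show ?thesis by (simp add: lq_coeff_def)
qed

lemma sums_ln_imp_prodinf:
  fixes f :: "nat \<Rightarrow> real"
  assumes "\<And>n. 0 < f n" and "(\<lambda>n. ln (f n)) sums l"
  shows "prodinf f = exp l"
proof -
  have "(\<lambda>n. exp (\<Sum>i\<le>n. ln (f i))) \<longlonglongrightarrow> exp l"
    using assms(2) by (intro tendsto_exp) (simp add: sums_def_le)
  then have "(\<lambda>n. \<Prod>i\<le>n. f i) \<longlonglongrightarrow> exp l"
    using assms(1) by (simp add: exp_sum)
  \<comment> \<open>The limit \<open>exp l\<close> is nonzero, as convergence of an infinite product
    demands.\<close>
  then have "f has_prod exp l"
    by (simp add: has_prod_def raw_has_prod_def)
  then show ?thesis using has_prod_unique by force
qed

text \<open>The numerators \<open>1 - q ^ (n + 1)\<close> are the denominators at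
  \<open>x = 1\<close>, which explains the subtracted value at 1.\<close>

lemma q_gamma_eq_exp:
  assumes q: "0 < q" "q < 1" and x: "0 < x"
  shows "q_gamma q x
    = (1 - q) powr (1 - x) * exp (qseries q (lq_coeff q) x - qseries q (lq_coeff q) 1)"
proof -
  have pos: "0 < 1 - q powr (real n + z)" if "0 < z" for n z
    using powr_less_one_pos[OF q, of "real n + z"] that by simp
  have pow: "q ^ (n + 1) = q powr (real n + 1)" for n
    using q by (simp add: powr_add powr_realpow)
  have "prodinf (\<lambda>n. (1 - q ^ (n + 1)) / (1 - q powr (real n + x)))
      = exp (qseries q (lq_coeff q) x - qseries q (lq_coeff q) 1)"
  proof (rule sums_ln_imp_prodinf)
    show "0 < (1 - q ^ (n + 1)) / (1 - q powr (real n + x))" for n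
      unfolding pow using x by (intro divide_pos_pos pos) auto
    have "(\<lambda>n. - ln (1 - q powr (real n + x)) - (- ln (1 - q powr (real n + 1)))) sums
        (qseries q (lq_coeff q) x - qseries q (lq_coeff q) 1)"
      using q x by (intro sums_diff ln_one_minus_sums_qseries) auto
    moreover have "- ln (1 - q powr (real n + x)) - (- ln (1 - q powr (real n + 1)))
        = ln ((1 - q ^ (n + 1)) / (1 - q powr (real n + x)))" for n
      unfolding pow using pos[OF x, of n] pos[of 1 n] by (simp add: ln_div)
    ultimately show "(\<lambda>n. ln ((1 - q ^ (n + 1)) / (1 - q powr (real n + x)))) sums
        (qseries q (lq_coeff q) x - qseries q (lq_coeff q) 1)"
      by simp
  qed
  then show ?thesis by (simp add: q_gamma_def)
qed

section \<open>Complete monotonicity\<close>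

text \<open>The quantity \<open>A = q powr u_qs q s\<close>, free of logarithms.\<close>

definition shift_base :: "real \<Rightarrow> real \<Rightarrow> real" where
  "shift_base q s = (q powr s - q) / ((1 - s) * (1 - q))"

text \<open>The upper bound is convexity of exp between 0 and \<open>ln q\<close>. Positivity makes
  \<open>ln A\<close> meaningful, and \<open>A \<le> 1\<close> keeps \<open>A * q powr x\<close>
  below 1 for \<open>x > 0\<close>.\<close>

lemma shift_base_bounds:
  assumes "0 < s" "s < 1" "0 < q" "q < 1"
  shows "0 < shift_base q s" "shift_base q s \<le> 1"
proof -
  have "q powr 1 < q powr s" using assms by (intro powr_less_mono') auto
  then show "0 < shift_base q s" using assms by (simp add: shift_base_def)
  have "exp ((1 - s) *\<^sub>R 0 + s *\<^sub>R ln q) \<le> (1 - s) * exp 0 + s * exp (ln q)"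
    using assms by (intro convex_onD[OF exp_convex]) auto
  then have "q powr s - q \<le> (1 - s) * (1 - q)"
    using assms by (simp add: powr_def algebra_simps)
  then show "shift_base q s \<le> 1" using assms by (simp add: shift_base_def)
qed

lemma powr_u_qs:
  assumes "0 < s" "s < 1" "0 < q" "q < 1"
  shows "q powr u_qs q s = shift_base q s"
  using assms shift_base_bounds(1)[OF assms] by (simp add: powr_def u_qs_def shift_base_def)

definition neg_log_coeff :: "real \<Rightarrow> real \<Rightarrow> nat \<Rightarrow> real" where
  "neg_log_coeff q s k =
     lq_coeff q k * (q powr s) ^ k - lq_coeff q k * q ^ k - (1 - s) * (shift_base q s ^ k / real k)"

text \<open>Writing \<open>q = q powr s * q powr (1 - s)\<close> and taking out
  \<open>(q powr s) ^ k\<close> leaves a nonnegative multiple of \<open>F k - F 1 ^ k\<close> with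
  \<open>r = 1 - s\<close>. For \<open>k = 0\<close> the coefficient is 0 by division by
  zero.\<close>

lemma neg_log_coeff_nonpos:
  assumes "0 < s" "s < 1" "0 < q" "q < 1"
  shows "neg_log_coeff q s k \<le> 0"
proof (cases k)
  case (Suc n)
  let ?p = "q powr (1 - s)"
  have qk: "q ^ k < 1" using assms Suc power_Suc_less_one by blast
  have qq: "q = q powr s * ?p" using assms by (simp flip: powr_add)
  have "neg_log_coeff q s k
      = (1 - s) / real k * (((q powr s) ^ k - q ^ k) / ((1 - s) * (1 - q ^ k)) - shift_base q s ^ k)"
  proof -
    have "1 / (m * w) * a - 1 / (m * w) * b - t * (d / m) = t / m * ((a - b) / (t * w) - d)"
      if "m \<noteq> 0" "w \<noteq> 0" "t \<noteq> 0" for a b d m t w :: real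
      using that by (simp add: field_simps)
    then show ?thesis
      unfolding neg_log_coeff_def lq_coeff_def using assms qk Suc by simp
  qed
  also have "\<dots> = (1 - s) / real k * (q powr s) ^ k *
      ((1 - ?p ^ k) / ((1 - s) * (1 - q ^ k)) - ((1 - ?p) / ((1 - s) * (1 - q))) ^ k)"
  proof -
    have "q ^ k = (q powr s) ^ k * ?p ^ k"
      using qq by (metis power_mult_distrib)
    then have num: "(q powr s) ^ k - q ^ k = (q powr s) ^ k * (1 - ?p ^ k)"
      by (simp only: right_diff_distrib mult_1_right)
    have "q powr s - q = q powr s * (1 - ?p)"
      using qq by (simp only: right_diff_distrib mult_1_right)
    then have base: "shift_base q s = q powr s * ((1 - ?p) / ((1 - s) * (1 - q)))"
      by (simp only: shift_base_def times_divide_eq_right)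
    show ?thesis
      unfolding num base power_mult_distrib
      by (simp only: mult.assoc right_diff_distrib[of "(q powr s) ^ k"] times_divide_eq_right)
  qed
  also have "\<dots> \<le> 0"
    using one_minus_power_ratio_le[of q "1 - s" n] assms Suc
    by (intro mult_nonneg_nonpos) auto
  finally show ?thesis .
qed (simp add: neg_log_coeff_def lq_coeff_def)

lemma summable_on_unit_scale:
  assumes "summable_on_unit c" and "\<bar>a\<bar> \<le> 1"
  shows "summable_on_unit (\<lambda>k. c k * a ^ k)"
  unfolding summable_on_unit_def
proof (intro allI impI)
  fix y :: real
  assume "\<bar>y\<bar> < 1"
  then have "\<bar>a * y\<bar> < 1"
    using assms(2) by (metis abs_mult abs_ge_zero mult_left_le_one_le order_le_less_trans)
  then show "summable (\<lambda>k. c k * a ^ k * y ^ k)"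
    using summable_on_unitD[OF assms(1), of "a * y"] by (simp add: power_mult_distrib mult_ac)
qed

lemma summable_on_unit_diff:
  "summable_on_unit c \<Longrightarrow> summable_on_unit d \<Longrightarrow> summable_on_unit (\<lambda>k. c k - d k)"
  unfolding summable_on_unit_def by (auto simp: left_diff_distrib intro!: summable_diff)

lemma summable_on_unit_neg_log_coeff:
  assumes "0 < s" "s < 1" "0 < q" "q < 1"
  shows "summable_on_unit (neg_log_coeff q s)"
proof -
  have "summable_on_unit (\<lambda>k. 1 / real k)"
    by (rule summable_on_unit_bounded[where B = 1]) (simp add: divide_simps)
  then have "summable_on_unit (\<lambda>k. 1 / real k * shift_base q s ^ k * (1 - s))"
    using shift_base_bounds[OF assms] by (intro summable_on_unit_cmult summable_on_unit_scale) auto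
  then show ?thesis
    unfolding neg_log_coeff_def[abs_def]
    using assms powr_less_one_pos[of q s]
    by (intro summable_on_unit_diff summable_on_unit_scale summable_on_unit_lq_coeff)
      (auto simp: mult_ac)
qed

lemma qseries_neg_log_coeff:
  assumes s: "0 < s" "s < 1" and q: "0 < q" "q < 1" and x: "0 < x"
  shows "qseries q (neg_log_coeff q s) x
    = qseries q (lq_coeff q) (x + s) - qseries q (lq_coeff q) (x + 1)
      + (1 - s) * ln (1 - shift_base q s * q powr x)"
proof -
  let ?A = "shift_base q s" and ?y = "q powr x"
  have lq: "(\<lambda>k. lq_coeff q k * (q powr z) ^ k) sums qseries q (lq_coeff q) z" if "0 < z" for z
    unfolding qseries_def using q that
    by (intro summable_sums summable_on_unitD[OF summable_on_unit_lq_coeff] powr_less_one_pos) auto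
  have "\<bar>?A * ?y\<bar> < 1"
    using shift_base_bounds[OF s q] powr_less_one_pos[OF q x]
    by (metis abs_mult abs_of_pos mult_left_le_one_le order_le_less_trans less_eq_real_def)
  then have "(\<lambda>k. lq_coeff q k * (q powr (x + s)) ^ k - lq_coeff q k * (q powr (x + 1)) ^ k
        - (1 - s) * ((?A * ?y) ^ k / real k)) sums
      (qseries q (lq_coeff q) (x + s) - qseries q (lq_coeff q) (x + 1)
        - (1 - s) * - ln (1 - ?A * ?y))"
    using s x by (intro sums_diff sums_mult lq neg_ln_one_minus_sums) auto
  moreover have "neg_log_coeff q s k * ?y ^ k
      = lq_coeff q k * (q powr (x + s)) ^ k - lq_coeff q k * (q powr (x + 1)) ^ k
        - (1 - s) * ((?A * ?y) ^ k / real k)" for k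
    using q by (simp add: neg_log_coeff_def powr_add power_mult_distrib algebra_simps)
  ultimately show ?thesis
    by (simp add: qseries_def[of q "neg_log_coeff q s"] sums_iff)
qed

text \<open>All multiples of \<open>ln (1 - q)\<close> cancel, as do the two normalising values at
  1, so only the series in \<open>q powr x\<close> remain.\<close>

lemma g_q_eq_exp_qseries:
  assumes s: "0 < s" "s < 1" and q: "0 < q" "q < 1" and x: "0 < x"
  shows "g_q q x s 1 (u_qs q s) = exp (- qseries q (neg_log_coeff q s) x)"
proof -
  let ?A = "shift_base q s" and ?y = "q powr x" and ?D = "qseries q (lq_coeff q)"
  have "?A * ?y < 1"
    using shift_base_bounds[OF s q] powr_less_one_pos[OF q x]
    by (metis mult_left_le_one_le order_le_less_trans less_eq_real_def)
  then have base: "((1 - ?A * ?y) / (1 - q)) powr (s - 1)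
      = exp ((s - 1) * ln (1 - ?A * ?y) - (s - 1) * ln (1 - q))"
    using q by (simp add: powr_def ln_div right_diff_distrib)
  have gamma: "q_gamma q z = exp ((1 - z) * ln (1 - q) + (?D z - ?D 1))" if "0 < z" for z
    using q_gamma_eq_exp[OF q that] q by (simp add: powr_def exp_add)
  have "g_q q x s 1 (u_qs q s)
      = exp ((s - 1) * ln (1 - ?A * ?y) - (s - 1) * ln (1 - q)
        + ((1 - (x + 1)) * ln (1 - q) + (?D (x + 1) - ?D 1)
          - ((1 - (x + s)) * ln (1 - q) + (?D (x + s) - ?D 1))))"
    using s x by (simp add: g_q_def powr_add powr_u_qs[OF s q] mult.commute[of ?y] base gamma
        flip: exp_diff exp_add)
  also have "\<dots> = exp (- qseries q (neg_log_coeff q s) x)"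
    unfolding qseries_neg_log_coeff[OF s q x] by (simp add: algebra_simps)
  finally show ?thesis .
qed

theorem theorem3p4:
  fixes q s :: real
  assumes "0 < s" and "s < 1" and "0 < q" and "q < 1"
  shows "log_completely_monotonic_on (\<lambda>x. g_q q x s 1 (u_qs q s)) {0<..}"
proof -
  let ?c = "neg_log_coeff q s"
  let ?h = "qseries q ?c"
  let ?c' = "\<lambda>k. ?c k * (real k * ln q)"
  have c: "summable_on_unit ?c"
    by (rule summable_on_unit_neg_log_coeff[OF assms])
  have h: "(?h has_real_derivative qseries q ?c' x) (at x)" if "0 < x" for x
    using qseries_has_derivative[OF assms(3,4) c that] .
  \<comment> \<open>Both \<open>?c k\<close> and \<open>real k * ln q\<close> are nonpositive, so
    the derivative series has nonnegative coefficients.\<close>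
  have "0 \<le> ?c' k" for k
    using neg_log_coeff_nonpos[OF assms, of k] assms
    by (intro mult_nonpos_nonpos) (auto simp: mult_nonneg_nonpos)
  then have "completely_monotonic_on (deriv ?h) {0<..}"
    \<comment> \<open>The exponent 1 gives convergence of the series with coefficients
      \<open>?c'\<close>.\<close>
    using assms summable_on_unit_deriv[OF c, of q 1]
    by (intro qseries_completely_monotonic[of q ?c']) (auto intro: DERIV_imp_deriv h)
  moreover have "g_q q x s 1 (u_qs q s) = exp (- ?h x)" if "0 < x" for x
    using g_q_eq_exp_qseries[OF assms that] .
  ultimately show ?thesis
    unfolding log_completely_monotonic_on_def
    using h by (auto simp: real_differentiable_def intro!: exI[of _ ?h])
qed

end
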